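(* Let $\alpha>0$, let $V$ satisfy the assumptions listed in the context (with parameters $d\in[1,+\infty)$, $\theta>0$), and let $g$ be either $g(x)=-\log|x|$ or $g(x)=|x|^{-s}$ with $0<s<1$. Set $x_0=0$ if $g=-\log|\cdot|$ and $x_0=\dfrac{2s}{1+s}$ if $g=|\cdot|^{-s}$. Then for all $x_0<x<1$, $$\limsup_{N\to\infty}\frac{1}{\log N}\log\log\left(\mathbb{P}_N\left(\overline{x_{\max}}<1-x\right)^{-1}\right)\ge1-(1-x)^d,$$ where $\overline{x_{\max}}=\dfrac{x_{\max}}{(\theta^{-1}\log N)^{1/d}}$.
   Context: Assumptions on $V$: $V:\mathbb{R}\to\mathbb{R}$ is continuous and $V(x)=\theta|x|^d+\varphi(x)$ with $d\in[1,+\infty)$ real, $\theta>0$, where as $|x|\to\infty$: $\varphi(x)=o(|x|^d)$; $\varphi$ is $\mathcal{C}^2$ outside of a compact set, $\varphi'(x)=o(|x|^{d-1})$, and for any $a<b$, $\sup_{y\in[a,b]}\varphi''(x+y)=o(|x|^{d-2})$. The probability measure $\mathbb{P}_N$ on $\mathbb{R}^N$ is $$d\mathbb{P}_N(x_1,\dots,x_N)=\frac{1}{\mathcal{Z}_N}\prod_{1\le i<j\le N}e^{-\frac{2\alpha}{N}g(x_i-x_j)}\prod_{i=1}^N e^{-V(x_i)}\,dx_1\cdots dx_N,$$ where $\mathcal{Z}_N$ is the normalization constant (finite under the assumptions). $x_{\max}=\max_{1\le i\le N}x_i$. *)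

theory Defs
  imports "HOL-Probability.Probability" "HOL-Library.Landau_Symbols"
begin

definition C2_on :: "real set \<Rightarrow> (real \<Rightarrow> real) \<Rightarrow> bool" where
  "C2_on S f \<longleftrightarrow>
     (\<forall>x\<in>S. f differentiable (at x)) \<and>
     (\<forall>x\<in>S. deriv f differentiable (at x)) \<and>
     continuous_on S (deriv (deriv f))"

text \<open>
  The filter \<^const>\<open>at_infinity\<close> on the reals is \<open>|x| \<rightarrow> \<infinity>\<close>, in both directions. The supremum in
  the last clause carries no absolute value. It is taken in the reals, and it is the supremum
  of a continuous function over a compact interval as soon as \<open>|x|\<close> is large.
\<close>

definition admissible_potential ::
  "real \<Rightarrow> real \<Rightarrow> (real \<Rightarrow> real) \<Rightarrow> (real \<Rightarrow> real) \<Rightarrow> bool" where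
  "admissible_potential d \<theta> \<phi> V \<longleftrightarrow>
     1 \<le> d \<and> 0 < \<theta> \<and>
     continuous_on UNIV V \<and>
     (\<forall>x. V x = \<theta> * \<bar>x\<bar> powr d + \<phi> x) \<and>
     \<phi> \<in> o[at_infinity](\<lambda>x. \<bar>x\<bar> powr d) \<and>
     (\<exists>K. compact K \<and> C2_on (- K) \<phi>) \<and>
     deriv \<phi> \<in> o[at_infinity](\<lambda>x. \<bar>x\<bar> powr (d - 1)) \<and>
     (\<forall>a b. a < b \<longrightarrow>
        (\<lambda>x. SUP y\<in>{a..b}. deriv (deriv \<phi>) (x + y)) \<in> o[at_infinity](\<lambda>x. \<bar>x\<bar> powr (d - 2)))"

text \<open>
  Both kernels get the value 0 at the origin by the conventions \<open>ln 0 = 0\<close> and \<open>0 powr a = 0\<close>.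
  This only affects configurations with coinciding points, a Lebesgue null set.
\<close>

definition log_kernel :: "real \<Rightarrow> real" where
  "log_kernel x = - ln \<bar>x\<bar>"

definition riesz_kernel :: "real \<Rightarrow> real \<Rightarrow> real" where
  "riesz_kernel s x = \<bar>x\<bar> powr (- s)"

text \<open>A configuration is a point of the product space over the index set \<open>{1..N}\<close>.\<close>

definition gas_weight ::
  "real \<Rightarrow> (real \<Rightarrow> real) \<Rightarrow> (real \<Rightarrow> real) \<Rightarrow> nat \<Rightarrow> (nat \<Rightarrow> real) \<Rightarrow> real" where
  "gas_weight \<alpha> g V N x =
     (\<Prod>(i, j)\<in>{(i, j). 1 \<le> i \<and> i < j \<and> j \<le> N}. exp (- (2 * \<alpha> / real N) * g (x i - x j))) *
     (\<Prod>i=1..N. exp (- V (x i)))"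

definition partition_function ::
  "real \<Rightarrow> (real \<Rightarrow> real) \<Rightarrow> (real \<Rightarrow> real) \<Rightarrow> nat \<Rightarrow> ennreal" where
  "partition_function \<alpha> g V N =
     (\<integral>\<^sup>+ x. ennreal (gas_weight \<alpha> g V N x) \<partial>(\<Pi>\<^sub>M i\<in>{1..N}. lborel))"

definition gas_measure ::
  "real \<Rightarrow> (real \<Rightarrow> real) \<Rightarrow> (real \<Rightarrow> real) \<Rightarrow> nat \<Rightarrow> (nat \<Rightarrow> real) measure" where
  "gas_measure \<alpha> g V N =
     density (\<Pi>\<^sub>M i\<in>{1..N}. lborel)
       (\<lambda>x. ennreal (gas_weight \<alpha> g V N x) / partition_function \<alpha> g V N)"

definition x_max :: "nat \<Rightarrow> (nat \<Rightarrow> real) \<Rightarrow> real" where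
  "x_max N x = Max (x ` {1..N})"

definition scaled_x_max :: "real \<Rightarrow> real \<Rightarrow> nat \<Rightarrow> (nat \<Rightarrow> real) \<Rightarrow> real" where
  "scaled_x_max d \<theta> N x = x_max N x / (ln (real N) / \<theta>) powr (1 / d)"

end

theory Submission
  imports Defs "HOL-Real_Asymp.Real_Asymp"
begin

text \<open>
  Let \<open>w\<close> be the Gibbs weight, \<open>D = (-\<infinity>, L)\<close> and \<open>J = [L, L + 1]\<close>, where
  \<open>L = (1 - x) (log N / \<theta>)\<^bsup>1/d\<^esup>\<close>. Freeze all particles but one. The energy of the free particle
  at \<open>u\<close> in the field of the others is a function of the frozen ones, common to all \<open>u\<close>, plus
  \<open>O(1) + O(log (1 + |u|))\<close>, up to an integrable singularity which Jensen's inequality averages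
  out. Hence the \<open>J\<close>-mass of \<open>w\<close> in this coordinate is at least \<open>r\<close> times its \<open>D\<close>-mass, where
  \<open>r\<close> is \<open>exp (- max\<^sub>J V)\<close> up to a power of \<open>L\<close> and does not depend on the frozen particles.
  Applied to one coordinate after the other this gives
  \<open>P (x\<^sub>m\<^sub>a\<^sub>x < L) \<le> (1 + r)\<^bsup>-N\<^esup>\<close>, and \<open>N r\<close> is \<open>N\<close> to the power \<open>1 - (1 - x)\<^sup>d + o(1)\<close>.
\<close>

section \<open>Integral estimates on the line\<close>

text \<open>The bound has to be uniform in \<open>z\<close>, the position of a frozen particle, and
  in \<open>L\<close>. At distance at least 1 from \<open>z\<close> the integrand is at most 1, on
  an interval of length 1. Closer to \<open>z\<close>, a translation leaves at most the integral of
  the singularity over \<open>{-1..1}\<close>, which is finite because \<open>s < 1\<close>.\<close>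

lemma nn_integral_powr_singularity_bounded:
  fixes s :: real
  assumes "0 < s" "s < 1"
  obtains K where "0 \<le> K"
    "\<And>z L. (\<integral>\<^sup>+u. ennreal (\<bar>u - z\<bar> powr -s) * indicator {L..L + 1} u \<partial>lborel) \<le> ennreal K"
proof -
  define f :: "real \<Rightarrow> real" where "f u = \<bar>u\<bar> powr -s * indicator {-1..1} u" for u
  have "((\<lambda>x. x powr -s) has_integral (1 / (1 - s))) {0..1}"
    using has_integral_powr_from_0[of "-s" 1] assms by (simp add: add.commute)
  hence pos: "((\<lambda>x. \<bar>x\<bar> powr -s) has_integral (1 / (1 - s))) {0..1}"
    by (rule has_integral_eq[rotated]) auto
  hence "((\<lambda>x. \<bar>-x\<bar> powr -s) has_integral (1 / (1 - s))) {-1..-0}"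
    by (subst has_integral_reflect_real) auto
  hence "((\<lambda>x. \<bar>x\<bar> powr -s) has_integral (1 / (1 - s) + 1 / (1 - s))) {-1..1}"
    by (intro has_integral_combine[where c = 0, OF _ _ _ pos]) auto
  hence "(f has_integral (2 / (1 - s))) UNIV"
    unfolding f_def by (subst (asm) has_integral_restrict_UNIV[symmetric])
      (simp add: indicator_def of_bool_def if_distrib cong: if_cong)
  moreover have [measurable]: "f \<in> borel_measurable borel"
    unfolding f_def by measurable
  ultimately have f: "(\<integral>\<^sup>+u. ennreal (f u) \<partial>lborel) = ennreal (2 / (1 - s))"
    by (intro nn_integral_has_integral_lborel[of f]) (auto simp: f_def)
  have "(\<integral>\<^sup>+u. ennreal (\<bar>u - z\<bar> powr -s) * indicator {L..L + 1} u \<partial>lborel) \<le> ennreal (1 + 2 / (1 - s))"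
    for z L :: real
  proof -
    have "\<bar>t\<bar> powr -s \<le> 1" if "\<bar>t\<bar> \<ge> 1" for t :: real
      using that assms powr_mono[of "-s" 0 "\<bar>t\<bar>"] by (auto split: if_splits)
    from this[of "_ - z"] have "(\<integral>\<^sup>+u. ennreal (\<bar>u - z\<bar> powr -s) * indicator {L..L + 1} u \<partial>lborel)
        \<le> (\<integral>\<^sup>+u. indicator {L..L + 1} u + ennreal (f (-z + 1 * u)) \<partial>lborel)"
      by (intro nn_integral_mono)
         (force simp: f_def indicator_def)
    also have "\<dots> = 1 + (\<integral>\<^sup>+u. ennreal (f (-z + 1 * u)) \<partial>lborel)"
      unfolding f_def by (subst nn_integral_add) auto
    also have "(\<integral>\<^sup>+u. ennreal (f (-z + 1 * u)) \<partial>lborel) = (\<integral>\<^sup>+u. ennreal (f u) \<partial>lborel)"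
      using nn_integral_real_affine[of "\<lambda>u. ennreal (f u)" 1 "-z"] by (simp add: f_def)
    finally show ?thesis
      using assms by (simp add: f ennreal_plus)
  qed
  thus thesis
    using assms by (intro that[of "1 + 2 / (1 - s)"]) auto
qed

text \<open>Jensen's inequality, which here follows from \<open>exp y \<ge> 1 + y\<close>.\<close>

lemma nn_integral_exp_minus_ge:
  fixes f :: "'a \<Rightarrow> real"
  assumes "prob_space M" and [measurable]: "f \<in> borel_measurable M"
    and nonneg: "\<And>u. 0 \<le> f u" and "0 \<le> m" and "(\<integral>\<^sup>+u. ennreal (f u) \<partial>M) \<le> ennreal m"
  shows "ennreal (exp (-m)) \<le> (\<integral>\<^sup>+u. ennreal (exp (- f u)) \<partial>M)"
proof -
  interpret prob_space M by fact
  have "ennreal (exp (-m)) * ennreal (1 + m) = (\<integral>\<^sup>+u. ennreal (exp (-m) * (1 + m)) \<partial>M)"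
    using \<open>0 \<le> m\<close> by (simp add: ennreal_mult emeasure_space_1)
  also have "\<dots> \<le> (\<integral>\<^sup>+u. ennreal (exp (- f u)) + ennreal (exp (-m)) * ennreal (f u) \<partial>M)"
  proof (intro nn_integral_mono)
    fix u
    have "exp (-m) * (1 + (m - f u)) \<le> exp (-m) * exp (m - f u)"
      by (intro mult_left_mono exp_ge_add_one_self) auto
    also have "\<dots> = exp (- f u)"
      by (simp flip: exp_add)
    finally have "exp (-m) * (1 + m) \<le> exp (- f u) + exp (-m) * f u"
      by (simp add: algebra_simps)
    thus "ennreal (exp (-m) * (1 + m)) \<le> ennreal (exp (- f u)) + ennreal (exp (-m)) * ennreal (f u)"
      using nonneg by (simp flip: ennreal_mult ennreal_plus add: ennreal_leI)
  qed
  also have "\<dots> = (\<integral>\<^sup>+u. ennreal (exp (- f u)) \<partial>M) + ennreal (exp (-m)) * (\<integral>\<^sup>+u. ennreal (f u) \<partial>M)"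
    by (subst nn_integral_add) (auto simp: nn_integral_cmult)
  also have "\<dots> \<le> (\<integral>\<^sup>+u. ennreal (exp (- f u)) \<partial>M) + ennreal (exp (-m)) * ennreal m"
    using assms by (intro add_left_mono mult_left_mono) auto
  finally have "ennreal (exp (-m)) * ennreal m + ennreal (exp (-m))
      \<le> ennreal (exp (-m)) * ennreal m + (\<integral>\<^sup>+u. ennreal (exp (- f u)) \<partial>M)"
    using \<open>0 \<le> m\<close> by (simp add: ennreal_plus distrib_left add.commute)
  thus ?thesis
    by (rule ennreal_add_left_cancel_le[THEN iffD1, THEN disjE]) (auto simp: ennreal_mult_eq_top_iff)
qed

section \<open>Iterating a one-coordinate inequality over a product space\<close>

text \<open>The one-coordinate inequality is assumed for all values of the other coordinates, so it
  passes to every section \<open>f (x(i := t))\<close>. The induction hypothesis, applied to such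
  sections, accounts for \<open>r ^ card F\<close> and the restrictions in \<open>F\<close>. After
  exchanging the integrals, the assumption in coordinate \<open>i\<close> supplies the last
  factor.\<close>

lemma (in product_sigma_finite) nn_integral_PiM_power_le:
  fixes r :: ennreal and D :: "'i \<Rightarrow> 'a set"
  assumes "finite I" and "f \<in> borel_measurable (Pi\<^sub>M I M)"
    and "\<And>i. i \<in> I \<Longrightarrow> D i \<in> sets (M i)"
    and "\<And>i x. i \<in> I \<Longrightarrow> x \<in> space (Pi\<^sub>M I M) \<Longrightarrow>
      r * (\<integral>\<^sup>+t. f (x(i := t)) * indicator (D i) t \<partial>M i) \<le> (\<integral>\<^sup>+t. f (x(i := t)) \<partial>M i)"
  shows "r ^ card I * (\<integral>\<^sup>+x. f x * indicator (Pi\<^sub>E I D) x \<partial>Pi\<^sub>M I M) \<le> (\<integral>\<^sup>+x. f x \<partial>Pi\<^sub>M I M)"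
  using assms
proof (induction I arbitrary: f rule: finite_induct)
  case empty
  thus ?case by (auto intro!: nn_integral_mono simp: indicator_def)
next
  case (insert i F)
  interpret F: finite_product_sigma_finite M F by standard (rule insert.hyps)
  note [measurable] = insert.prems(1)
  have D [measurable]: "Pi\<^sub>E (insert i F) D \<in> sets (Pi\<^sub>M (insert i F) M)" "Pi\<^sub>E F D \<in> sets (Pi\<^sub>M F M)"
    using insert by (auto intro!: sets_PiM_I_finite)
  have [measurable]: "D i \<in> sets (M i)" using insert by auto
  have split: "(indicator (Pi\<^sub>E (insert i F) D) (x(i := t)) :: ennreal) = indicator (Pi\<^sub>E F D) x * indicator (D i) t"
    if "x \<in> space (Pi\<^sub>M F M)" for x t
    using that insert.hyps
    by (auto simp: indicator_def PiE_iff space_PiM extensional_def split: if_splits)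
  have "r ^ card (insert i F) * (\<integral>\<^sup>+x. f x * indicator (Pi\<^sub>E (insert i F) D) x \<partial>Pi\<^sub>M (insert i F) M)
      = r ^ card (insert i F) * (\<integral>\<^sup>+t. (\<integral>\<^sup>+x. f (x(i := t)) * indicator (Pi\<^sub>E (insert i F) D) (x(i := t)) \<partial>Pi\<^sub>M F M) \<partial>M i)"
    using insert.hyps by (subst product_nn_integral_insert_rev) auto
  also have "\<dots> = r ^ card (insert i F) * (\<integral>\<^sup>+t. (\<integral>\<^sup>+x. f (x(i := t)) * indicator (Pi\<^sub>E F D) x \<partial>Pi\<^sub>M F M) * indicator (D i) t \<partial>M i)"
  proof (intro arg_cong2[where f = "(*)"] refl nn_integral_cong)
    fix t assume "t \<in> space (M i)"
    hence [measurable]: "(\<lambda>x. f (x(i := t))) \<in> borel_measurable (Pi\<^sub>M F M)"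
      by measurable
    show "(\<integral>\<^sup>+x. f (x(i := t)) * indicator (Pi\<^sub>E (insert i F) D) (x(i := t)) \<partial>Pi\<^sub>M F M)
        = (\<integral>\<^sup>+x. f (x(i := t)) * indicator (Pi\<^sub>E F D) x \<partial>Pi\<^sub>M F M) * indicator (D i) t"
      by (subst nn_integral_multc[symmetric])
         (auto intro!: nn_integral_cong simp: split mult.assoc)
  qed
  also have "\<dots> = r * (\<integral>\<^sup>+t. (r ^ card F * (\<integral>\<^sup>+x. f (x(i := t)) * indicator (Pi\<^sub>E F D) x \<partial>Pi\<^sub>M F M)) * indicator (D i) t \<partial>M i)"
    using insert.hyps by (simp add: mult.assoc nn_integral_cmult)
  also have "\<dots> \<le> r * (\<integral>\<^sup>+t. (\<integral>\<^sup>+x. f (x(i := t)) \<partial>Pi\<^sub>M F M) * indicator (D i) t \<partial>M i)"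
  proof (intro mult_left_mono nn_integral_mono mult_right_mono insert.IH)
    fix t assume t: "t \<in> space (M i)"
    show "(\<lambda>x. f (x(i := t))) \<in> borel_measurable (Pi\<^sub>M F M)"
      using t by measurable
    fix j x assume j: "j \<in> F" and x: "x \<in> space (Pi\<^sub>M F M)"
    have upd: "x(i := t) \<in> space (Pi\<^sub>M (insert i F) M)"
      using x t by (auto simp: space_PiM PiE_iff extensional_def)
    \<comment> \<open>Updates at distinct indices commute, so the assumption for \<open>j\<close>
      can be used at the configuration whose coordinate \<open>i\<close> is frozen at
      \<open>t\<close>.\<close>
    have twist: "x(j := u, i := t) = x(i := t, j := u)" for u
      using j insert.hyps by (intro fun_upd_twist) auto
    show "r * (\<integral>\<^sup>+ u. f (x(j := u, i := t)) * indicator (D j) u \<partial>M j) \<le> (\<integral>\<^sup>+ u. f (x(j := u, i := t)) \<partial>M j)"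
      unfolding twist by (rule insert.prems(3)) (use j upd in \<open>auto simp: fun_upd_def\<close>)
  qed (use insert in auto)
  also have "\<dots> = r * (\<integral>\<^sup>+t. (\<integral>\<^sup>+x. f (x(i := t)) * indicator (D i) t \<partial>Pi\<^sub>M F M) \<partial>M i)"
    by (intro arg_cong2[where f = "(*)"] refl nn_integral_cong nn_integral_multc[symmetric]) measurable
  also have "\<dots> = r * (\<integral>\<^sup>+x. (\<integral>\<^sup>+t. f (x(i := t)) * indicator (D i) t \<partial>M i) \<partial>Pi\<^sub>M F M)"
    by (intro arg_cong2[where f = "(*)"] refl pair_sigma_finite.Fubini'[symmetric])
       (auto intro!: pair_sigma_finite.intro F.sigma_finite_measure_axioms sigma_finite_measures)
  also have "\<dots> = (\<integral>\<^sup>+x. r * (\<integral>\<^sup>+t. f (x(i := t)) * indicator (D i) t \<partial>M i) \<partial>Pi\<^sub>M F M)"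
    by (intro nn_integral_cmult[symmetric]) measurable
  also have "\<dots> \<le> (\<integral>\<^sup>+x. (\<integral>\<^sup>+t. f (x(i := t)) \<partial>M i) \<partial>Pi\<^sub>M F M)"
  proof (intro nn_integral_mono)
    fix x assume x: "x \<in> space (Pi\<^sub>M F M)"
    show "r * (\<integral>\<^sup>+t. f (x(i := t)) * indicator (D i) t \<partial>M i) \<le> (\<integral>\<^sup>+t. f (x(i := t)) \<partial>M i)"
    \<comment> \<open>The assumption speaks of points of the full product, so \<open>x\<close> first
      needs some coordinate \<open>i\<close>. Its value \<open>t0\<close> is overwritten at once. If
      there is no such value, both integrals vanish.\<close>
    proof (cases "space (M i) = {}")
      case True
      have "(\<integral>\<^sup>+t. h t \<partial>M i) = 0" for h :: "'a \<Rightarrow> ennreal"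
        using True nn_integral_cong[of "M i" h "\<lambda>_. 0"] by simp
      thus ?thesis by simp
    next
      case False
      then obtain t0 where "t0 \<in> space (M i)" by auto
      hence "x(i := t0) \<in> space (Pi\<^sub>M (insert i F) M)"
        using x by (auto simp: space_PiM PiE_iff extensional_def)
      from insert.prems(3)[OF insertI1 this] show ?thesis
        by (simp only: fun_upd_upd)
    qed
  qed
  also have "\<dots> = (\<integral>\<^sup>+x. f x \<partial>Pi\<^sub>M (insert i F) M)"
    using insert.hyps by (subst product_nn_integral_insert) auto
  finally show ?case .
qed

section \<open>Finiteness of the moments of \<open>exp (- V)\<close>\<close>

text \<open>Powers of \<open>1 + |u|\<close> are what logarithmic interactions become after
  exponentiation. Linear growth of \<open>V\<close> beats them: even with an extra factor
  \<open>1 + u^2\<close> the integrand stays bounded, so it is dominated by a multiple of the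
  integrable function \<open>1 / (1 + u^2)\<close>.\<close>

lemma nn_integral_moment_finite:
  fixes V :: "real \<Rightarrow> real"
  assumes V: "continuous_on UNIV V" and "0 < c"
    and growth: "\<forall>\<^sub>F u in at_infinity. c * \<bar>u\<bar> \<le> V u"
  shows "(\<integral>\<^sup>+u. ennreal ((1 + \<bar>u\<bar>) powr p * exp (- V u)) \<partial>lborel) < \<infinity>"
proof -
  define f where "f u = (1 + u\<^sup>2) * ((1 + \<bar>u\<bar>) powr p * exp (- V u))" for u
  have cont: "continuous_on A f" for A
    unfolding f_def by (intro continuous_intros continuous_on_subset[OF V]) auto
  \<comment> \<open>In logarithmic scale the polynomial factors are \<open>o(u)\<close>, hence
    eventually below \<open>c * u\<close>.\<close>
  have "((\<lambda>u::real. ln (1 + u\<^sup>2) / u) \<longlongrightarrow> 0) at_top" "((\<lambda>u::real. ln (1 + u) / u) \<longlongrightarrow> 0) at_top"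
    by real_asymp+
  hence "((\<lambda>u. ln (1 + u\<^sup>2) / u + p * (ln (1 + u) / u)) \<longlongrightarrow> 0 + p * 0) at_top"
    by (intro tendsto_intros)
  hence "\<forall>\<^sub>F u in at_top. ln (1 + u\<^sup>2) / u + p * (ln (1 + u) / u) < c"
    using \<open>0 < c\<close> by (intro order_tendstoD) auto
  hence "\<forall>\<^sub>F u in at_top. (1 + u\<^sup>2) * ((1 + u) powr p * exp (- (c * u))) \<le> 1"
    using eventually_gt_at_top[of 0]
  proof eventually_elim
    case (elim u)
    have "(1 + u\<^sup>2) * ((1 + u) powr p * exp (- (c * u))) = exp (ln (1 + u\<^sup>2) + p * ln (1 + u) - c * u)"
      using elim by (simp add: exp_diff exp_add powr_def exp_minus divide_inverse add_pos_nonneg)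
    also have "\<dots> \<le> 1" using elim by (simp add: field_simps)
    finally show ?case .
  qed
  then obtain R1 where R1: "\<And>u. u \<ge> R1 \<Longrightarrow> (1 + u\<^sup>2) * ((1 + u) powr p * exp (- (c * u))) \<le> 1"
    by (auto simp: eventually_at_top_linorder)
  obtain R2 where R2: "\<And>u. R2 \<le> norm u \<Longrightarrow> c * \<bar>u\<bar> \<le> V u"
    using growth by (auto simp: eventually_at_infinity)
  define R where "R = max R1 R2"
  have "bounded (f ` {-R..R})"
    by (intro compact_imp_bounded compact_continuous_image cont) auto
  then obtain B where "\<forall>y\<in>f ` {-R..R}. norm y \<le> B"
    by (auto simp: bounded_iff)
  hence B: "\<bar>f u\<bar> \<le> B" if "u \<in> {-R..R}" for u
    using that by auto
  have le: "f u \<le> max B 1" for u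
  proof (cases "\<bar>u\<bar> \<le> R")
    case True
    thus ?thesis using B[of u] by (auto simp: le_max_iff_disj abs_le_iff)
  next
    case False
    have "f u \<le> (1 + \<bar>u\<bar>\<^sup>2) * ((1 + \<bar>u\<bar>) powr p * exp (- (c * \<bar>u\<bar>)))"
      unfolding f_def using R2[of u] False by (intro mult_mono) (auto simp: R_def)
    also have "\<dots> \<le> 1" using R1[of "\<bar>u\<bar>"] False by (auto simp: R_def)
    finally show ?thesis by simp
  qed
  have int: "integrable lborel (\<lambda>x::real. inverse (1 + x\<^sup>2))"
    using integrable_inverse_1_plus_square by (simp add: set_integrable_def)
  have "(\<integral>\<^sup>+u. ennreal ((1 + \<bar>u\<bar>) powr p * exp (- V u)) \<partial>lborel)
      \<le> (\<integral>\<^sup>+u. ennreal (max B 1) * ennreal (inverse (1 + u\<^sup>2)) \<partial>lborel)"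
  proof (intro nn_integral_mono)
    fix u :: real
    have "0 < 1 + u\<^sup>2" by (simp add: add_pos_nonneg)
    hence "(1 + \<bar>u\<bar>) powr p * exp (- V u) \<le> max B 1 * inverse (1 + u\<^sup>2)"
      using le[of u] unfolding f_def divide_inverse[symmetric]
      by (subst pos_le_divide_eq) (simp_all add: mult.commute)
    thus "ennreal ((1 + \<bar>u\<bar>) powr p * exp (- V u)) \<le> ennreal (max B 1) * ennreal (inverse (1 + u\<^sup>2))"
      by (subst ennreal_mult[symmetric]) (auto intro: ennreal_leI)
  qed
  also have "\<dots> = ennreal (max B 1) * (\<integral>\<^sup>+u. ennreal (inverse (1 + u\<^sup>2)) \<partial>lborel)"
    by (intro nn_integral_cmult) auto
  also have "\<dots> < \<infinity>"
    using int by (simp add: integrable_iff_bounded ennreal_mult_less_top)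
  finally show ?thesis .
qed

section \<open>The gas: standing bounds, Gibbs weight and partition function\<close>

text \<open>
  The logarithmic kernel fits with \<open>\<beta> = 1\<close>, the Riesz kernel with \<open>\<beta> = 0\<close>. In the bounds on \<open>g\<close> the
  dependence on the position \<open>z\<close> of the other particle is the same from both sides, so it cancels
  when two positions \<open>u\<close> are compared.
\<close>

locale tame_gas =
  fixes \<alpha> \<beta> C s :: real and g V :: "real \<Rightarrow> real"
  assumes \<alpha>: "0 < \<alpha>" and \<beta>: "0 \<le> \<beta>" and C: "0 \<le> C" and s: "0 < s" "s < 1"
    and g_measurable [measurable]: "g \<in> borel_measurable borel"
    and g_even: "g (- t) = g t"
    and g_lower: "- g (u - z) \<le> \<beta> * (ln (1 + \<bar>u\<bar>) + ln (1 + \<bar>z\<bar>))"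
    and g_upper: "\<beta> * (ln (1 + \<bar>z\<bar>) - ln (1 + \<bar>u\<bar>)) - C * \<bar>u - z\<bar> powr -s \<le> - g (u - z)"
    and V_cont: "continuous_on UNIV V"
    and moments: "(\<integral>\<^sup>+u. ennreal ((1 + \<bar>u\<bar>) powr p * exp (- V u)) \<partial>lborel) < \<infinity>"
begin

abbreviation config_space :: "nat \<Rightarrow> (nat \<Rightarrow> real) measure" where
  "config_space N \<equiv> \<Pi>\<^sub>M i\<in>{1..N}. lborel"

lemma V_measurable [measurable]: "V \<in> borel_measurable borel"
  using V_cont by (rule borel_measurable_continuous_onI)

lemma gas_weight_pos: "0 < gas_weight \<alpha> g V N x"
  unfolding gas_weight_def by (intro mult_pos_pos prod_pos) auto

lemma gas_weight_measurable [measurable]: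
  "gas_weight \<alpha> g V N \<in> borel_measurable (config_space N)"
proof -
  have "(\<lambda>x. x i) \<in> borel_measurable (config_space N)" if "i \<in> {1..N}" for i
    using measurable_component_singleton[OF that, of "\<lambda>_. lborel"] by simp
  thus ?thesis
    unfolding gas_weight_def
    by (intro borel_measurable_times borel_measurable_prod)
       (auto intro!: borel_measurable_exp borel_measurable_times borel_measurable_uminus
          measurable_compose[OF _ g_measurable] measurable_compose[OF _ V_measurable] borel_measurable_diff)
qed

text \<open>\<open>A\<close> collects the factors that do not see particle \<open>i\<close>: the
  pairs avoiding \<open>i\<close> and the confinement of the others. The ordering of a pair
  containing \<open>i\<close> is immaterial because \<open>g\<close> is even.\<close>

lemma gas_weight_upd:
  assumes i: "i \<in> {1..N}"
  obtains A where "0 \<le> A"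
    "\<And>t. gas_weight \<alpha> g V N (x(i := t)) =
       A * (exp (\<Sum>j\<in>{1..N} - {i}. 2 * \<alpha> / N * - g (t - x j)) * exp (- V t))"
proof -
  define P where "P = {(a, b). 1 \<le> a \<and> a < b \<and> b \<le> N}"
  \<comment> \<open>Each pair containing \<open>i\<close> is \<open>(min i j, max i j)\<close> for
    exactly one \<open>j\<close>, so \<open>Q\<close> consists of the pairs avoiding
    \<open>i\<close>.\<close>
  define Q where "Q = P - (\<lambda>j. (min i j, max i j)) ` ({1..N} - {i})"
  define e where "e t = exp (- (2 * \<alpha> / N) * g t)" for t
  define A where "A = (\<Prod>(a, b)\<in>Q. e (x a - x b)) * (\<Prod>j\<in>{1..N} - {i}. exp (- V (x j)))"
  have finite: "finite P"
    by (rule finite_subset[of _ "{1..N} \<times> {1..N}"]) (auto simp: P_def)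
  have sub: "(\<lambda>j. (min i j, max i j)) ` ({1..N} - {i}) \<subseteq> P"
    using i by (auto simp: P_def min_def max_def)
  have inj: "inj_on (\<lambda>j. (min i j, max i j)) ({1..N} - {i})"
    by (auto simp: inj_on_def min_def max_def split: if_splits)
  have Q: "a \<noteq> i" "b \<noteq> i" if "(a, b) \<in> Q" for a b
  proof -
    have "(a, b) \<in> (\<lambda>j. (min i j, max i j)) ` ({1..N} - {i})" if "a = i" "(a, b) \<in> P"
      using that by (intro image_eqI[of _ _ b]) (auto simp: P_def)
    moreover have "(a, b) \<in> (\<lambda>j. (min i j, max i j)) ` ({1..N} - {i})" if "b = i" "(a, b) \<in> P"
      using that by (intro image_eqI[of _ _ a]) (auto simp: P_def)
    ultimately show "a \<noteq> i" "b \<noteq> i" using that by (auto simp: Q_def)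
  qed
  have "gas_weight \<alpha> g V N (x(i := t)) =
      A * (exp (\<Sum>j\<in>{1..N} - {i}. 2 * \<alpha> / N * - g (t - x j)) * exp (- V t))" for t
  proof -
    let ?y = "x(i := t)"
    have "(\<Prod>(a, b)\<in>P. e (?y a - ?y b))
        = (\<Prod>(a, b)\<in>Q. e (?y a - ?y b)) * (\<Prod>j\<in>{1..N} - {i}. e (?y (min i j) - ?y (max i j)))"
      unfolding Q_def by (subst prod.subset_diff[OF sub finite], subst prod.reindex[OF inj]) (simp add: o_def)
    also have "(\<Prod>(a, b)\<in>Q. e (?y a - ?y b)) = (\<Prod>(a, b)\<in>Q. e (x a - x b))"
      using Q by (intro prod.cong) auto
    also have "(\<Prod>j\<in>{1..N} - {i}. e (?y (min i j) - ?y (max i j))) = (\<Prod>j\<in>{1..N} - {i}. e (t - x j))"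
      using g_even[of "t - x _"] by (intro prod.cong) (auto simp: e_def min_def max_def)
    also have "\<dots> = exp (\<Sum>j\<in>{1..N} - {i}. 2 * \<alpha> / N * - g (t - x j))"
      by (subst exp_sum) (auto simp: e_def)
    finally have 1: "(\<Prod>(a, b)\<in>P. e (?y a - ?y b)) =
      (\<Prod>(a, b)\<in>Q. e (x a - x b)) * exp (\<Sum>j\<in>{1..N} - {i}. 2 * \<alpha> / N * - g (t - x j))" .
    have 2: "(\<Prod>j=1..N. exp (- V (?y j))) = exp (- V t) * (\<Prod>j\<in>{1..N} - {i}. exp (- V (x j)))"
      using i by (subst prod.remove[of _ i]) (auto intro!: prod.cong)
    show ?thesis
      using 1 2 unfolding gas_weight_def A_def P_def e_def by (simp add: mult_ac)
  qed
  moreover have "0 \<le> A"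
    unfolding A_def by (intro mult_nonneg_nonneg prod_nonneg) (auto simp: e_def)
  ultimately show thesis using that by blast
qed

text \<open>By \<open>g_lower\<close> the logarithmic growth of each pair factor is controlled by a
  sum of one-particle terms. The weight is then dominated by a product of one-variable functions,
  whose integral factorises into moments.\<close>

lemma partition_function_finite: "partition_function \<alpha> g V N < \<infinity>"
proof -
  define P where "P = {(a, b). 1 \<le> a \<and> a < b \<and> b \<le> N}"
  define U where "U x = (\<Sum>k=1..N. \<beta> * ln (1 + \<bar>x k\<bar>))" for x :: "nat \<Rightarrow> real"
  \<comment> \<open>A crude exponent: every one of the \<open>card P\<close> pairs is charged with
    the one-particle terms of all particles.\<close>
  define q where "q = card P * (2 * \<alpha> / N) * \<beta>"
  interpret product_sigma_finite "\<lambda>_. lborel :: real measure" ..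
  have finite: "finite P"
    by (rule finite_subset[of _ "{1..N} \<times> {1..N}"]) (auto simp: P_def)
  have le: "gas_weight \<alpha> g V N x \<le> (\<Prod>k=1..N. (1 + \<bar>x k\<bar>) powr q * exp (- V (x k)))" for x
  proof -
    have "(\<Prod>(a, b)\<in>P. exp (- (2 * \<alpha> / N) * g (x a - x b))) \<le> (\<Prod>p\<in>P. exp (2 * \<alpha> / N * U x))"
    proof (intro prod_mono, clarify, intro conjI)
      fix a b assume "(a, b) \<in> P"
      hence "- g (x a - x b) \<le> (\<Sum>k\<in>{a, b}. \<beta> * ln (1 + \<bar>x k\<bar>))"
        using g_lower[of "x a" "x b"] by (auto simp: P_def algebra_simps)
      also have "\<dots> \<le> U x"
        unfolding U_def using \<open>(a, b) \<in> P\<close> \<beta> by (intro sum_mono2) (auto simp: P_def)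
      finally show "exp (- (2 * \<alpha> / N) * g (x a - x b)) \<le> exp (2 * \<alpha> / N * U x)"
        using \<alpha> mult_left_mono[of "- g (x a - x b)" "U x" "2 * \<alpha> / N"] by simp
    qed auto
    also have "\<dots> = exp (\<Sum>k=1..N. q * ln (1 + \<bar>x k\<bar>))"
      by (simp add: U_def q_def sum_distrib_left mult_ac flip: exp_of_nat_mult)
    also have "\<dots> = (\<Prod>k=1..N. (1 + \<bar>x k\<bar>) powr q)"
      by (subst exp_sum) (auto simp: powr_def add_nonneg_eq_0_iff intro!: prod.cong)
    finally show ?thesis
      unfolding gas_weight_def P_def prod.distrib
      by (intro mult_right_mono prod_nonneg) auto
  qed
  have "partition_function \<alpha> g V N
      \<le> (\<integral>\<^sup>+x. (\<Prod>k=1..N. ennreal ((1 + \<bar>x k\<bar>) powr q * exp (- V (x k)))) \<partial>config_space N)"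
    unfolding partition_function_def using le
    by (intro nn_integral_mono) (auto simp: prod_ennreal intro!: ennreal_leI)
  also have "\<dots> = (\<Prod>k=1..N. \<integral>\<^sup>+u. ennreal ((1 + \<bar>u\<bar>) powr q * exp (- V u)) \<partial>lborel)"
    by (intro product_nn_integral_prod) auto
  also have "\<dots> < \<infinity>"
    using moments[of q] by (auto simp: power_less_top_ennreal)
  finally show ?thesis .
qed

section \<open>Comparing the two masses in one coordinate\<close>

lemma moment_pos: "0 < (\<integral>\<^sup>+u. ennreal ((1 + \<bar>u\<bar>) powr p * exp (- V u)) \<partial>lborel)"
proof -
  have "\<not> (AE u in lborel. ennreal ((1 + \<bar>u\<bar>) powr p * exp (- V u)) = 0)"
  proof
    assume "AE u in lborel. ennreal ((1 + \<bar>u\<bar>) powr p * exp (- V u)) = 0"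
    hence "AE u in lborel. u \<notin> (UNIV :: real set)"
      by eventually_elim (auto simp: ennreal_eq_0_iff mult_le_0_iff add_pos_nonneg not_le)
    thus False
      by (subst (asm) AE_iff_measurable[of UNIV]) auto
  qed
  thus ?thesis
    by (subst zero_less_iff_neq_zero, subst nn_integral_0_iff_AE) auto
qed

lemma coordinate_gain:
  obtains \<kappa> where "0 < \<kappa>" "\<kappa> \<le> 1"
    "\<And>(N::nat) i x L S. i \<in> {1..N} \<Longrightarrow> 0 \<le> L \<Longrightarrow> (\<And>u. u \<in> {L..L + 1} \<Longrightarrow> V u \<le> S) \<Longrightarrow>
       ennreal (\<kappa> * (2 + L) powr (- (2 * \<alpha> * \<beta>)) * exp (- S)) *
         (\<integral>\<^sup>+t. ennreal (gas_weight \<alpha> g V N (x(i := t))) * indicator {..<L} t \<partial>lborel)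
       \<le> (\<integral>\<^sup>+t. ennreal (gas_weight \<alpha> g V N (x(i := t))) * indicator {L..L + 1} t \<partial>lborel)"
proof -
  obtain K where K: "0 \<le> K" "\<And>z L. (\<integral>\<^sup>+u. ennreal (\<bar>u - z\<bar> powr -s) * indicator {L..L + 1} u \<partial>lborel) \<le> ennreal K"
    using nn_integral_powr_singularity_bounded[OF s] by blast
  \<comment> \<open>Fewer than \<open>N\<close> particles act on the free one, each with coupling
    \<open>2 * \<alpha> / N\<close>. The total coupling is thus at most \<open>2 * \<alpha>\<close>,
    uniformly in \<open>N\<close>; this gives both \<open>p\<close> and, below,
    \<open>m\<close>.\<close>
  define p where "p = 2 * \<alpha> * \<beta>"
  obtain M where M: "0 < M" "(\<integral>\<^sup>+u. ennreal ((1 + \<bar>u\<bar>) powr p * exp (- V u)) \<partial>lborel) = ennreal M"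
    using moments[of p] moment_pos[of p]
    by (cases "\<integral>\<^sup>+u. ennreal ((1 + \<bar>u\<bar>) powr p * exp (- V u)) \<partial>lborel") (auto simp: less_top)
  define m where "m = 2 * \<alpha> * C * K"
  \<comment> \<open>\<open>exp (- m)\<close> is the Jensen bound on the interval and
    \<open>M\<close> bounds the half-line. The cap at 1 later keeps the gain below 1.\<close>
  define \<kappa> where "\<kappa> = min 1 (exp (- m) / M)"
  have "0 \<le> m" using \<alpha> C K by (simp add: m_def)
  show thesis
  proof (rule that)
    show "0 < \<kappa>" "\<kappa> \<le> 1" using M by (auto simp: \<kappa>_def)
    fix N i :: nat and x and L S :: real
    assume i: "i \<in> {1..N}" and L: "0 \<le> L" and S: "\<And>u. u \<in> {L..L + 1} \<Longrightarrow> V u \<le> S"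
    define J where "J = {1..N} - {i}"
    define c where "c = 2 * \<alpha> / N"
    define h where "h t = (\<Sum>j\<in>J. c * - g (t - x j))" for t
    define B where "B = (\<Sum>j\<in>J. c * (\<beta> * ln (1 + \<bar>x j\<bar>)))"
    define f where "f t = (\<Sum>j\<in>J. c * C * \<bar>t - x j\<bar> powr -s)" for t
    have N: "N > 0" using i by auto
    have c: "0 \<le> c" using \<alpha> by (simp add: c_def)
    have J: "finite J" "card J * c \<le> 2 * \<alpha>"
      using \<alpha> i N by (auto simp: J_def c_def field_simps)
    have f_nonneg: "0 \<le> f t" for t
      unfolding f_def using c C by (intro sum_nonneg) auto
    have [measurable]: "h \<in> borel_measurable borel" "f \<in> borel_measurable borel"
      unfolding h_def f_def by measurable
    obtain A where A: "0 \<le> A" "\<And>t. gas_weight \<alpha> g V N (x(i := t)) = A * (exp (h t) * exp (- V t))"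
      using gas_weight_upd[OF i, of x] unfolding h_def c_def J_def by blast
    have card: "card J * c * (\<beta> * ln (1 + \<bar>t\<bar>)) \<le> p * ln (1 + \<bar>t\<bar>)" for t
      using mult_right_mono[OF J(2), of "\<beta> * ln (1 + \<bar>t\<bar>)"] \<beta> by (simp add: p_def mult_ac)

    have h_le: "exp (h t) \<le> exp B * (1 + \<bar>t\<bar>) powr p" for t
    proof -
      have "h t \<le> (\<Sum>j\<in>J. c * (\<beta> * ln (1 + \<bar>x j\<bar>)) + c * (\<beta> * ln (1 + \<bar>t\<bar>)))"
        unfolding h_def using mult_left_mono[OF g_lower c]
        by (intro sum_mono) (simp add: algebra_simps)
      also have "\<dots> = B + card J * c * (\<beta> * ln (1 + \<bar>t\<bar>))"
        by (simp add: B_def sum.distrib)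
      also have "\<dots> \<le> B + p * ln (1 + \<bar>t\<bar>)" using card by simp
      finally have "exp (h t) \<le> exp (B + p * ln (1 + \<bar>t\<bar>))" by simp
      also have "\<dots> = exp B * (1 + \<bar>t\<bar>) powr p"
        by (auto simp: exp_add powr_def add_nonneg_eq_0_iff)
      finally show ?thesis .
    qed
    have h_ge: "exp B * (2 + L) powr (- p) * exp (- f t) \<le> exp (h t)" if "t \<in> {L..L + 1}" for t
    proof -
      have "card J * c * (\<beta> * ln (1 + \<bar>t\<bar>)) \<le> p * ln (1 + \<bar>t\<bar>)" by (rule card)
      \<comment> \<open>On the interval \<open>1 + |t|\<close> is at most
        \<open>2 + L\<close>.\<close>
      also have "\<dots> \<le> p * ln (2 + L)"
        using that L \<alpha> \<beta> by (intro mult_left_mono) (auto simp: p_def)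
      finally have "B - p * ln (2 + L) - f t \<le> B - card J * c * (\<beta> * ln (1 + \<bar>t\<bar>)) - f t" by simp
      also have "\<dots> = (\<Sum>j\<in>J. c * (\<beta> * (ln (1 + \<bar>x j\<bar>) - ln (1 + \<bar>t\<bar>)) - C * \<bar>t - x j\<bar> powr -s))"
        by (simp add: B_def f_def sum_subtractf sum.distrib algebra_simps)
      also have "\<dots> \<le> h t"
        unfolding h_def using mult_left_mono[OF g_upper c] by (intro sum_mono)
      finally have "exp (B - p * ln (2 + L) - f t) \<le> exp (h t)" by simp
      thus ?thesis
        using L by (simp add: powr_def add.commute flip: exp_add)
    qed

    have "(\<integral>\<^sup>+t. ennreal (gas_weight \<alpha> g V N (x(i := t))) * indicator {..<L} t \<partial>lborel)
        \<le> (\<integral>\<^sup>+t. ennreal (A * exp B) * ennreal ((1 + \<bar>t\<bar>) powr p * exp (- V t)) \<partial>lborel)"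
    proof (intro nn_integral_mono)
      fix t
      have "gas_weight \<alpha> g V N (x(i := t)) \<le> A * exp B * ((1 + \<bar>t\<bar>) powr p * exp (- V t))"
        using mult_left_mono[OF mult_right_mono[OF h_le[of t], of "exp (- V t)"] A(1)] A(2)
        by (simp add: mult_ac)
      thus "ennreal (gas_weight \<alpha> g V N (x(i := t))) * indicator {..<L} t
          \<le> ennreal (A * exp B) * ennreal ((1 + \<bar>t\<bar>) powr p * exp (- V t))"
        using A by (subst ennreal_mult[symmetric]) (auto intro!: ennreal_leI simp: indicator_def)
    qed
    also have "\<dots> = ennreal (A * exp B * M)"
      using A M by (simp add: nn_integral_cmult ennreal_mult)
    finally have upper: "(\<integral>\<^sup>+t. ennreal (gas_weight \<alpha> g V N (x(i := t))) * indicator {..<L} t \<partial>lborel)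
        \<le> ennreal (A * exp B * M)" .

    \<comment> \<open>The interval has length 1, so Lebesgue measure on it is a probability and
      Jensen applies directly.\<close>
    define U where "U = restrict_space lborel {L..L + 1}"
    have "prob_space U"
      by (rule prob_spaceI) (simp add: U_def emeasure_restrict_space)
    moreover have [measurable]: "f \<in> borel_measurable U"
      unfolding U_def by (intro measurable_restrict_space1) simp
    moreover have "(\<integral>\<^sup>+u. ennreal (f u) \<partial>U) \<le> ennreal m"
    proof -
      have "(\<integral>\<^sup>+u. ennreal (f u) \<partial>U)
          = (\<integral>\<^sup>+u. (\<Sum>j\<in>J. ennreal (c * C) * (ennreal (\<bar>u - x j\<bar> powr -s) * indicator {L..L + 1} u)) \<partial>lborel)"
        unfolding U_def f_def using c C
        by (subst nn_integral_restrict_space)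
           (auto simp: sum_ennreal[symmetric] ennreal_mult sum_distrib_right mult.assoc intro!: nn_integral_cong)
      also have "\<dots> = (\<Sum>j\<in>J. ennreal (c * C) * (\<integral>\<^sup>+u. ennreal (\<bar>u - x j\<bar> powr -s) * indicator {L..L + 1} u \<partial>lborel))"
        by (subst nn_integral_sum) (auto simp: nn_integral_cmult)
      also have "\<dots> \<le> (\<Sum>j\<in>J. ennreal (c * C) * ennreal K)"
        by (intro sum_mono mult_left_mono K) auto
      also have "\<dots> = ennreal (card J * c * (C * K))"
        using c C K by (simp add: ennreal_mult ennreal_of_nat_eq_real_of_nat mult_ac)
      also have "\<dots> \<le> ennreal m"
        using mult_right_mono[OF J(2), of "C * K"] C K by (intro ennreal_leI) (simp add: m_def mult_ac)
      finally show ?thesis .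
    qed
    ultimately have exp_f: "ennreal (exp (- m)) \<le> (\<integral>\<^sup>+u. ennreal (exp (- f u)) \<partial>U)"
      using \<open>0 \<le> m\<close> by (intro nn_integral_exp_minus_ge f_nonneg)
    define a where "a = A * exp B * (2 + L) powr (- p) * exp (- S)"
    have "0 \<le> a" using A by (simp add: a_def)
    have "ennreal (a * exp (- m)) \<le> ennreal a * (\<integral>\<^sup>+u. ennreal (exp (- f u)) \<partial>U)"
      using exp_f \<open>0 \<le> a\<close> by (simp add: ennreal_mult mult_left_mono)
    also have "\<dots> = (\<integral>\<^sup>+t. ennreal (a * exp (- f t)) * indicator {L..L + 1} t \<partial>lborel)"
      unfolding U_def using \<open>0 \<le> a\<close>
      by (subst nn_integral_restrict_space)
         (auto simp: nn_integral_cmult[symmetric] ennreal_mult mult.assoc)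
    also have "\<dots> \<le> (\<integral>\<^sup>+t. ennreal (gas_weight \<alpha> g V N (x(i := t))) * indicator {L..L + 1} t \<partial>lborel)"
    proof (intro nn_integral_mono)
      fix t
      show "ennreal (a * exp (- f t)) * indicator {L..L + 1} t
          \<le> ennreal (gas_weight \<alpha> g V N (x(i := t))) * indicator {L..L + 1} t"
      proof (cases "t \<in> {L..L + 1}")
        case True
        have "(exp B * (2 + L) powr (- p) * exp (- f t)) * exp (- S) \<le> exp (h t) * exp (- V t)"
          using h_ge[OF True] S[OF True] by (intro mult_mono) auto
        from mult_left_mono[OF this A(1)]
        have "a * exp (- f t) \<le> gas_weight \<alpha> g V N (x(i := t))"
          by (simp add: a_def A(2) mult_ac)
        thus ?thesis by (intro mult_right_mono ennreal_leI) auto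
      qed auto
    qed
    finally have lower: "ennreal (a * exp (- m)) \<le> (\<integral>\<^sup>+t. ennreal (gas_weight \<alpha> g V N (x(i := t))) * indicator {L..L + 1} t \<partial>lborel)" .

    have "ennreal (\<kappa> * (2 + L) powr (- p) * exp (- S)) *
         (\<integral>\<^sup>+t. ennreal (gas_weight \<alpha> g V N (x(i := t))) * indicator {..<L} t \<partial>lborel)
       \<le> ennreal (\<kappa> * (2 + L) powr (- p) * exp (- S)) * ennreal (A * exp B * M)"
      using upper by (intro mult_left_mono) auto
    also have "\<dots> = ennreal (a * (\<kappa> * M))"
      using A M \<open>0 < \<kappa>\<close> by (subst ennreal_mult[symmetric]) (auto simp: a_def mult_ac)
    also have "\<dots> \<le> ennreal (a * exp (- m))"
      using M \<open>0 \<le> a\<close> by (intro ennreal_leI mult_left_mono) (auto simp: \<kappa>_def min_def field_simps)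
    also note lower
    finally show "ennreal (\<kappa> * (2 + L) powr (- (2 * \<alpha> * \<beta>)) * exp (- S)) *
         (\<integral>\<^sup>+t. ennreal (gas_weight \<alpha> g V N (x(i := t))) * indicator {..<L} t \<partial>lborel)
       \<le> (\<integral>\<^sup>+t. ennreal (gas_weight \<alpha> g V N (x(i := t))) * indicator {L..L + 1} t \<partial>lborel)"
      unfolding p_def .
  qed
qed

section \<open>Probability that all particles lie below a level\<close>

text \<open>The weight is positive everywhere, and the region contains a cube of side 1, hence of
  volume 1. Positivity ensures that the inverse probability and its logarithms are not default
  values.\<close>

lemma half_space_mass_pos:
  "0 < (\<integral>\<^sup>+x. ennreal (gas_weight \<alpha> g V N x) * indicator (Pi\<^sub>E {1..N} (\<lambda>_. {..<L})) x \<partial>config_space N)"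
proof -
  interpret product_sigma_finite "\<lambda>_. lborel :: real measure" ..
  have [measurable]: "Pi\<^sub>E {1..N} (\<lambda>_. {..<L}) \<in> sets (config_space N)"
    by (intro sets_PiM_I_finite) auto
  define E where "E = Pi\<^sub>E {1..N} (\<lambda>_. {L - 1<..<L})"
  have E [measurable]: "E \<in> sets (config_space N)"
    unfolding E_def by (intro sets_PiM_I_finite) auto
  have "emeasure (config_space N) E = 1"
    unfolding E_def by (subst emeasure_PiM) auto
  have "\<not> (AE x in config_space N.
      ennreal (gas_weight \<alpha> g V N x) * indicator (Pi\<^sub>E {1..N} (\<lambda>_. {..<L})) x = 0)"
  proof
    assume "AE x in config_space N.
      ennreal (gas_weight \<alpha> g V N x) * indicator (Pi\<^sub>E {1..N} (\<lambda>_. {..<L})) x = 0"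
    hence "AE x in config_space N. x \<notin> E"
      by eventually_elim
        (auto simp: E_def PiE_iff indicator_def ennreal_eq_0_iff gas_weight_pos[THEN not_le[THEN iffD2]] split: if_splits)
    hence "emeasure (config_space N) E = 0"
      using E by (subst (asm) AE_iff_measurable[of E]) (auto dest: sets.sets_into_space)
    with \<open>emeasure (config_space N) E = 1\<close> show False by simp
  qed
  thus ?thesis
    by (subst zero_less_iff_neq_zero, subst nn_integral_0_iff_AE) (auto simp del: One_nat_def)
qed

text \<open>In each coordinate the mass below \<open>L\<close> and the mass on
  \<open>{L..L + 1}\<close> add up to at most the total, so the gain \<open>r\<close> yields a
  factor \<open>1 + r\<close> per coordinate. \<open>nn_integral_PiM_power_le\<close> multiplies
  these factors.\<close>

lemma void_probability:
  assumes r: "0 \<le> r" and gain: "\<And>i x. i \<in> {1..N} \<Longrightarrow>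
      ennreal r * (\<integral>\<^sup>+t. ennreal (gas_weight \<alpha> g V N (x(i := t))) * indicator {..<L} t \<partial>lborel)
       \<le> (\<integral>\<^sup>+t. ennreal (gas_weight \<alpha> g V N (x(i := t))) * indicator {L..L + 1} t \<partial>lborel)"
  defines "p \<equiv> measure (gas_measure \<alpha> g V N) (Pi\<^sub>E {1..N} (\<lambda>_. {..<L}))"
  shows "0 < p" "p * (1 + r) ^ N \<le> 1"
proof -
  interpret product_sigma_finite "\<lambda>_. lborel :: real measure" ..
  define E where "E = Pi\<^sub>E {1..N} (\<lambda>_. {..<L})"
  have E [measurable]: "E \<in> sets (config_space N)"
    unfolding E_def by (intro sets_PiM_I_finite) auto
  define Z where "Z = partition_function \<alpha> g V N"
  define b where "b = (\<integral>\<^sup>+x. ennreal (gas_weight \<alpha> g V N x) * indicator E x \<partial>config_space N)"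
  have Zb: "(1 + ennreal r) ^ N * b \<le> Z"
  proof -
    have "(1 + ennreal r) ^ card {1..N} * b \<le> Z"
      unfolding Z_def b_def E_def partition_function_def
    proof (rule nn_integral_PiM_power_le)
      fix i x assume i: "i \<in> {1..N}" and x: "x \<in> space (config_space N)"
      have "(\<lambda>t. x(i := t)) \<in> lborel \<rightarrow>\<^sub>M config_space N"
        using i x by (intro measurable_fun_upd[where J = "{1..N}"]) auto
      hence [measurable]: "(\<lambda>t. gas_weight \<alpha> g V N (x(i := t))) \<in> borel_measurable lborel"
        by (rule measurable_compose[OF _ gas_weight_measurable])
      have "(1 + ennreal r) * (\<integral>\<^sup>+t. ennreal (gas_weight \<alpha> g V N (x(i := t))) * indicator {..<L} t \<partial>lborel)
        \<le> (\<integral>\<^sup>+t. ennreal (gas_weight \<alpha> g V N (x(i := t))) * indicator {..<L} t \<partial>lborel)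
        + (\<integral>\<^sup>+t. ennreal (gas_weight \<alpha> g V N (x(i := t))) * indicator {L..L + 1} t \<partial>lborel)"
        using gain[OF i, of x] by (simp add: distrib_right add_left_mono)
      also have "\<dots> = (\<integral>\<^sup>+t. ennreal (gas_weight \<alpha> g V N (x(i := t))) * indicator {..<L} t
          + ennreal (gas_weight \<alpha> g V N (x(i := t))) * indicator {L..L + 1} t \<partial>lborel)"
        by (intro nn_integral_add[symmetric]) auto
      \<comment> \<open>The two sets are disjoint, so their indicators sum to at most 1.\<close>
      also have "\<dots> \<le> (\<integral>\<^sup>+t. ennreal (gas_weight \<alpha> g V N (x(i := t))) \<partial>lborel)"
        by (intro nn_integral_mono) (auto simp: indicator_def)
      finally show "(1 + ennreal r) * (\<integral>\<^sup>+t. ennreal (gas_weight \<alpha> g V N (x(i := t))) * indicator {..<L} t \<partial>lborel)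
        \<le> (\<integral>\<^sup>+t. ennreal (gas_weight \<alpha> g V N (x(i := t))) \<partial>lborel)" .
    qed (use gas_weight_measurable in auto)
    thus ?thesis by simp
  qed
  have "b \<le> Z"
    unfolding b_def Z_def partition_function_def
    by (intro nn_integral_mono) (auto simp: indicator_def)
  moreover have "0 < b"
    unfolding b_def E_def by (rule half_space_mass_pos)
  moreover have "Z < \<infinity>"
    unfolding Z_def by (rule partition_function_finite)
  \<comment> \<open>Both masses are positive and finite, so the quotient can be computed in the
    reals.\<close>
  ultimately obtain b' Z' where b': "b = ennreal b'" "0 < b'" and Z': "Z = ennreal Z'" "0 < Z'"
    by (cases b; cases Z) (auto simp: less_top top_unique)
  have "emeasure (gas_measure \<alpha> g V N) E
      = (\<integral>\<^sup>+x. (ennreal (gas_weight \<alpha> g V N x) * indicator E x) / Z \<partial>config_space N)"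
    unfolding gas_measure_def Z_def[symmetric]
    by (subst emeasure_density) (auto simp: divide_ennreal_def mult_ac simp del: One_nat_def intro!: nn_integral_cong)
  also have "\<dots> = b / Z"
    unfolding b_def by (intro nn_integral_divide) (auto simp del: One_nat_def)
  also have "\<dots> = ennreal (b' / Z')"
    using b' Z' by (simp add: divide_ennreal)
  finally have p: "p = b' / Z'"
    using b' Z' by (simp add: p_def E_def measure_def)
  show "0 < p"
    using b' Z' by (simp add: p)
  have "ennreal ((1 + r) ^ N * b') \<le> ennreal Z'"
    using Zb r b' Z' by (simp add: ennreal_mult flip: ennreal_power ennreal_plus ennreal_1)
  thus "p * (1 + r) ^ N \<le> 1"
    using Z' by (simp add: p mult_ac)
qed

text \<open>For \<open>0 < r <= 1\<close> one has \<open>exp (r / 2) <= 1 + r\<close>, so the bound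
  \<open>(1 + r)^(-N)\<close> gives \<open>- ln p >= N * r / 2\<close>. One more logarithm turns the
  factors of \<open>r\<close> into the summands of the claim.\<close>

lemma ln_ln_void_probability_ge:
  obtains c where
    "\<And>(N::nat) L S. N > 0 \<Longrightarrow> 0 \<le> L \<Longrightarrow> 0 \<le> S \<Longrightarrow> (\<And>u. u \<in> {L..L + 1} \<Longrightarrow> V u \<le> S) \<Longrightarrow>
      ln (real N) + c - 2 * \<alpha> * \<beta> * ln (2 + L) - S
        \<le> ln (ln (inverse (measure (gas_measure \<alpha> g V N) (Pi\<^sub>E {1..N} (\<lambda>_. {..<L})))))"
proof -
  obtain \<kappa> where \<kappa>: "0 < \<kappa>" "\<kappa> \<le> 1"
    "\<And>(N::nat) i x L S. i \<in> {1..N} \<Longrightarrow> 0 \<le> L \<Longrightarrow> (\<And>u. u \<in> {L..L + 1} \<Longrightarrow> V u \<le> S) \<Longrightarrow>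
       ennreal (\<kappa> * (2 + L) powr (- (2 * \<alpha> * \<beta>)) * exp (- S)) *
         (\<integral>\<^sup>+t. ennreal (gas_weight \<alpha> g V N (x(i := t))) * indicator {..<L} t \<partial>lborel)
       \<le> (\<integral>\<^sup>+t. ennreal (gas_weight \<alpha> g V N (x(i := t))) * indicator {L..L + 1} t \<partial>lborel)"
    using coordinate_gain by blast
  show thesis
  proof (rule that)
    fix N :: nat and L S :: real
    assume N: "N > 0" and L: "0 \<le> L" and S: "0 \<le> S" "\<And>u. u \<in> {L..L + 1} \<Longrightarrow> V u \<le> S"
    define r where "r = \<kappa> * (2 + L) powr (- (2 * \<alpha> * \<beta>)) * exp (- S)"
    define p where "p = measure (gas_measure \<alpha> g V N) (Pi\<^sub>E {1..N} (\<lambda>_. {..<L}))"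
    have "0 < r" using \<kappa> L by (simp add: r_def)
    \<comment> \<open>All three factors of \<open>r\<close> are at most 1; \<open>r <= 1\<close> is
      what the quadratic bound on \<open>exp\<close> below relies on.\<close>
    have "(2 + L) powr (- (2 * \<alpha> * \<beta>)) \<le> (2 + L) powr 0"
      using L \<alpha> \<beta> by (intro powr_mono) auto
    hence "r \<le> 1 * 1 * 1"
      unfolding r_def using \<kappa> L S by (intro mult_mono) auto
    note gain = \<kappa>(3)[OF _ L S(2), of _ N, folded r_def]
    have p: "0 < p" "p * (1 + r) ^ N \<le> 1"
      unfolding p_def using void_probability[OF less_imp_le[OF \<open>0 < r\<close>] gain] by auto
    have "exp (r / 2) \<le> 1 + r / 2 + (r / 2)\<^sup>2"
      using \<open>0 < r\<close> \<open>r \<le> 1 * 1 * 1\<close> by (intro exp_bound) auto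
    also have "(r / 2)\<^sup>2 \<le> r / 2"
      using \<open>0 < r\<close> \<open>r \<le> 1 * 1 * 1\<close> by (simp add: power2_eq_square field_simps)
    finally have "exp (r / 2) \<le> 1 + r" by simp
    hence "exp (r / 2) ^ N \<le> (1 + r) ^ N" by (intro power_mono) auto
    also have "\<dots> \<le> inverse p" using p by (simp add: field_simps)
    finally have "exp (real N * (r / 2)) \<le> inverse p"
      by (simp only: exp_of_nat_mult)
    hence "real N * (r / 2) \<le> ln (inverse p)"
      using p by (subst ln_ge_iff) auto
    \<comment> \<open>Monotonicity is available because \<open>N * r / 2\<close> is positive, which
      makes \<open>ln (inverse p)\<close> positive too.\<close>
    hence "ln (real N * (r / 2)) \<le> ln (ln (inverse p))"
      using N \<open>0 < r\<close> by (subst ln_le_cancel_iff) (auto intro: less_le_trans[of 0 "real N * (r / 2)"])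
    moreover have "ln (real N * (r / 2)) = ln N + (ln \<kappa> - ln 2) - 2 * \<alpha> * \<beta> * ln (2 + L) - S"
      using N \<kappa> L by (simp add: r_def ln_mult ln_div ln_powr)
    ultimately show "ln (real N) + (ln \<kappa> - ln 2) - 2 * \<alpha> * \<beta> * ln (2 + L) - S \<le> ln (ln (inverse p))"
      by simp
  qed
qed

end

section \<open>The logarithmic kernel and the growth of the potential\<close>

text \<open>Both bounds come from \<open>1 + |a + b| <= (1 + |a|) * (1 + |b|)\<close>. For the
  second, with \<open>t = |u - z|\<close>, the difference between \<open>ln (1 + t)\<close> and
  \<open>ln t\<close> is \<open>ln (1 + 1 / t)\<close>, which an integrable power of
  \<open>t\<close> dominates.\<close>

lemma log_kernel_bounds:
  "- log_kernel (u - z) \<le> ln (1 + \<bar>u\<bar>) + ln (1 + \<bar>z\<bar>)" (is ?lower)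
  "ln (1 + \<bar>z\<bar>) - ln (1 + \<bar>u\<bar>) - 2 * \<bar>u - z\<bar> powr -(1/2) \<le> - log_kernel (u - z)" (is ?upper)
proof -
  have tri: "ln (1 + \<bar>a + b\<bar>) \<le> ln (1 + \<bar>a\<bar>) + ln (1 + \<bar>b\<bar>)" for a b :: real
  proof -
    have "1 + \<bar>a + b\<bar> \<le> (1 + \<bar>a\<bar>) * (1 + \<bar>b\<bar>)"
      using abs_triangle_ineq[of a b] mult_nonneg_nonneg[of "\<bar>a\<bar>" "\<bar>b\<bar>"]
      unfolding distrib_left distrib_right mult_1 mult_1_right by linarith
    hence "ln (1 + \<bar>a + b\<bar>) \<le> ln ((1 + \<bar>a\<bar>) * (1 + \<bar>b\<bar>))"
      by (intro ln_mono) auto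
    thus ?thesis by (simp add: ln_mult_pos add_pos_nonneg)
  qed
  have "ln \<bar>u - z\<bar> \<le> ln (1 + \<bar>u - z\<bar>)"
    by (cases "u = z") (auto intro!: ln_mono)
  thus ?lower
    using tri[of u "-z"] by (simp add: log_kernel_def)
  show ?upper
  \<comment> \<open>At \<open>u = z\<close> both sides are 0 by the conventions for
    \<open>ln 0\<close> and \<open>0 powr a\<close>.\<close>
  proof (cases "u = z")
    case False
    define t where "t = \<bar>u - z\<bar>"
    have t: "0 < t" using False by (simp add: t_def)
    \<comment> \<open>Passing to the square root before using \<open>ln (1 + y) <= y\<close> lowers
      the singularity from \<open>1 / t\<close> to \<open>2 / sqrt t\<close>, which is
      integrable.\<close>
    have "1 + 1 / t \<le> (1 + 1 / sqrt t)\<^sup>2"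
      using t by (simp add: power2_sum power_divide)
    hence "ln (1 + 1 / t) \<le> ln ((1 + 1 / sqrt t)\<^sup>2)"
      using t by (intro ln_mono) (auto intro: add_pos_nonneg)
    also have "\<dots> = 2 * ln (1 + 1 / sqrt t)"
      using t by (subst ln_realpow) (auto intro: add_pos_nonneg)
    also have "\<dots> \<le> 2 * (1 / sqrt t)"
      using t by (intro mult_left_mono ln_add_one_self_le_self) auto
    also have "1 / sqrt t = t powr -(1/2)"
      using t by (simp add: powr_minus powr_half_sqrt field_simps)
    finally have "ln (1 + 1 / t) \<le> 2 * t powr -(1/2)" .
    moreover have "ln (1 + t) = ln t + ln (1 + 1 / t)"
      using t by (subst ln_mult_pos[symmetric]) (auto simp: distrib_left intro: add_pos_nonneg)
    ultimately show ?thesis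
      using tri[of u "z - u"] by (simp add: log_kernel_def t_def abs_minus_commute)
  qed (simp add: log_kernel_def)
qed

text \<open>Both bounds express that the perturbation is \<open>o(|u|^d)\<close>; for the second,
  \<open>|u| <= |u|^d\<close> once \<open>|u| >= 1\<close>. The first controls the cost
  \<open>S\<close> of placing a particle just above \<open>L\<close>, the second gives the
  moments.\<close>

lemma admissible_potential_growth:
  assumes "admissible_potential d \<theta> \<phi> V" and "0 < \<epsilon>"
  shows "\<forall>\<^sub>F u in at_infinity. V u \<le> (\<theta> + \<epsilon>) * \<bar>u\<bar> powr d"
    and "\<forall>\<^sub>F u in at_infinity. \<theta> / 2 * \<bar>u\<bar> \<le> V u"
proof -
  from assms have V: "V u = \<theta> * \<bar>u\<bar> powr d + \<phi> u" and d: "1 \<le> d" and \<theta>: "0 < \<theta>"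
    and \<phi>: "\<phi> \<in> o[at_infinity](\<lambda>u. \<bar>u\<bar> powr d)" for u
    by (auto simp: admissible_potential_def)
  show "\<forall>\<^sub>F u in at_infinity. V u \<le> (\<theta> + \<epsilon>) * \<bar>u\<bar> powr d"
    using landau_o.smallD[OF \<phi> \<open>0 < \<epsilon>\<close>] by eventually_elim (auto simp: V algebra_simps)
  have "\<forall>\<^sub>F u :: real in at_infinity. 1 \<le> \<bar>u\<bar>"
    unfolding eventually_at_infinity by (intro exI[of _ 1]) auto
  moreover have "\<forall>\<^sub>F u in at_infinity. norm (\<phi> u) \<le> \<theta> / 2 * norm (\<bar>u\<bar> powr d)"
    using landau_o.smallD[OF \<phi>, of "\<theta> / 2"] \<theta> by auto
  ultimately show "\<forall>\<^sub>F u in at_infinity. \<theta> / 2 * \<bar>u\<bar> \<le> V u"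
  proof eventually_elim
    case (elim u)
    have "\<theta> / 2 * \<bar>u\<bar> \<le> \<theta> / 2 * \<bar>u\<bar> powr d"
      using elim d \<theta> powr_mono[of 1 d "\<bar>u\<bar>"] by (intro mult_left_mono) auto
    also have "\<dots> \<le> V u"
      using elim by (auto simp: V)
    finally show ?case .
  qed
qed

section \<open>Asymptotics in \<open>N\<close> and conclusion\<close>

text \<open>With \<open>L = a * (ln N / \<theta>)^(1/d)\<close> one has
  \<open>\<theta> * L^d = a^d * ln N\<close>. Taking
  \<open>S = (\<theta> + \<epsilon>) * (L + 1)^d\<close>, the ratio \<open>S / ln N\<close> tends to
  \<open>(\<theta> + \<epsilon>) / \<theta> * a^d\<close>, while \<open>ln (2 + L)\<close> is
  negligible against \<open>ln N\<close>. The lower bound holds for all large \<open>N\<close> and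
  converges.\<close>

lemma (in tame_gas) limsup_void_probability_ge:
  fixes a d \<theta> \<epsilon> :: real
  assumes a: "0 < a" and d: "1 \<le> d" and \<theta>: "0 < \<theta>" and \<epsilon>: "0 < \<epsilon>"
    and growth: "\<forall>\<^sub>F u in at_infinity. V u \<le> (\<theta> + \<epsilon>) * \<bar>u\<bar> powr d"
  shows "ereal (1 - (\<theta> + \<epsilon>) / \<theta> * a powr d) \<le>
    limsup (\<lambda>N. ereal (1 / ln (real N) * ln (ln (inverse (measure (gas_measure \<alpha> g V N)
             {\<omega> \<in> space (gas_measure \<alpha> g V N). scaled_x_max d \<theta> N \<omega> < a})))))"
proof -
  define L where "L n = a * (ln n / \<theta>) powr (1 / d)" for n :: real
  obtain c where c:
    "\<And>(N::nat) L S. N > 0 \<Longrightarrow> 0 \<le> L \<Longrightarrow> 0 \<le> S \<Longrightarrow> (\<And>u. u \<in> {L..L + 1} \<Longrightarrow> V u \<le> S) \<Longrightarrow>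
      ln (real N) + c - 2 * \<alpha> * \<beta> * ln (2 + L) - S
        \<le> ln (ln (inverse (measure (gas_measure \<alpha> g V N) (Pi\<^sub>E {1..N} (\<lambda>_. {..<L})))))"
    using ln_ln_void_probability_ge by blast
  define q where "q N = ln (ln (inverse (measure (gas_measure \<alpha> g V N)
             {\<omega> \<in> space (gas_measure \<alpha> g V N). scaled_x_max d \<theta> N \<omega> < a})))" for N
  define lb where "lb n = (ln n + c - 2 * \<alpha> * \<beta> * ln (2 + L n) - (\<theta> + \<epsilon>) * (L n + 1) powr d) / ln n" for n
  obtain R where R: "\<And>u. R \<le> \<bar>u\<bar> \<Longrightarrow> V u \<le> (\<theta> + \<epsilon>) * \<bar>u\<bar> powr d"
    using growth by (auto simp: eventually_at_infinity)
  \<comment> \<open>The level tends to infinity, so the unit interval above it eventually lies where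
    the growth bound holds.\<close>
  have "\<forall>\<^sub>F n in at_top. R \<le> L n"
    unfolding L_def using a d \<theta> by real_asymp
  hence "\<forall>\<^sub>F N in sequentially. R \<le> L (real N)"
    by (rule eventually_compose_filterlim[OF _ filterlim_real_sequentially])
  \<comment> \<open>From \<open>N = 2\<close> on, \<open>ln N\<close> is positive and the scaling
    can be multiplied out; the index set of the maximum is also nonempty.\<close>
  moreover have "\<forall>\<^sub>F N in sequentially. 2 \<le> N"
    by (rule eventually_ge_at_top)
  ultimately have ev: "\<forall>\<^sub>F N in sequentially. ereal (lb (real N)) \<le> ereal (1 / ln (real N) * q N)"
  proof eventually_elim
    case (elim N)
    have pos: "0 < ln (real N)" "0 < (ln (real N) / \<theta>) powr (1 / d)" "0 < L (real N)"
      using elim a \<theta> by (auto simp: L_def)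
    have "{\<omega> \<in> space (gas_measure \<alpha> g V N). scaled_x_max d \<theta> N \<omega> < a} = Pi\<^sub>E {1..N} (\<lambda>_. {..<L (real N)})"
      using elim pos
      by (auto simp: gas_measure_def space_PiM scaled_x_max_def x_max_def L_def PiE_iff extensional_def field_simps)
    moreover have "V u \<le> (\<theta> + \<epsilon>) * (L (real N) + 1) powr d" if "u \<in> {L (real N)..L (real N) + 1}" for u
    proof -
      have "V u \<le> (\<theta> + \<epsilon>) * \<bar>u\<bar> powr d"
        using that elim by (intro R) auto
      also have "\<dots> \<le> (\<theta> + \<epsilon>) * (L (real N) + 1) powr d"
        using that pos \<theta> \<epsilon> d by (intro mult_left_mono powr_mono2) auto
      finally show ?thesis .
    qed
    ultimately have "ln (real N) + c - 2 * \<alpha> * \<beta> * ln (2 + L (real N)) - (\<theta> + \<epsilon>) * (L (real N) + 1) powr d \<le> q N"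
      using c[of N "L (real N)" "(\<theta> + \<epsilon>) * (L (real N) + 1) powr d"] pos elim \<theta> \<epsilon> by (simp add: q_def)
    thus ?case
      using pos by (simp add: lb_def divide_right_mono)
  qed
  have "(lb \<longlongrightarrow> 1 - (\<theta> + \<epsilon>) / \<theta> * a powr d) at_top"
  proof -
    \<comment> \<open>Substituting \<open>ln n = \<theta> * y^d\<close> and
      \<open>L n = a * y\<close> turns \<open>lb\<close> into \<open>F\<close>, whose terms are
      elementary in the single variable \<open>y\<close>.\<close>
    define y where "y n = (ln n / \<theta>) powr (1 / d)" for n :: real
    define F where "F u = 1 + c / (\<theta> * u powr d) - 2 * \<alpha> * \<beta> / \<theta> * (ln (2 + a * u) / u powr d)
      - (\<theta> + \<epsilon>) / \<theta> * (a + 1 / u) powr d" for u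
    have "((\<lambda>u. c / (\<theta> * u powr d)) \<longlongrightarrow> 0) at_top"
      using d \<theta> by real_asymp
    moreover have "((\<lambda>u. ln (2 + a * u) / u powr d) \<longlongrightarrow> 0) at_top"
      using a d by real_asymp
    moreover have "((\<lambda>u. a + 1 / u) \<longlongrightarrow> a) at_top"
      by real_asymp
    ultimately have "(F \<longlongrightarrow> 1 + 0 - 2 * \<alpha> * \<beta> / \<theta> * 0 - (\<theta> + \<epsilon>) / \<theta> * a powr d) at_top"
      unfolding F_def using a by (intro tendsto_intros) auto
    moreover have "filterlim y at_top at_top"
      unfolding y_def using d \<theta> by real_asymp
    ultimately have "((\<lambda>n. F (y n)) \<longlongrightarrow> 1 - (\<theta> + \<epsilon>) / \<theta> * a powr d) at_top"
      by (auto intro: filterlim_compose)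
    moreover have "\<forall>\<^sub>F n in at_top. F (y n) = lb n"
      using eventually_gt_at_top[of 1]
    proof eventually_elim
      case (elim n)
      have y: "0 < y n" using elim \<theta> by (simp add: y_def)
      have ln: "ln n = \<theta> * y n powr d"
        using elim d \<theta> by (simp add: y_def powr_powr)
      have L: "L n = a * y n" by (simp add: L_def y_def)
      have pw: "(a * y n + 1) powr d = (a + 1 / y n) powr d * y n powr d"
        using y a by (subst powr_mult[symmetric]) (auto simp: distrib_right)
      show "F (y n) = lb n"
        unfolding F_def lb_def L ln pw using y \<theta>
        by (simp add: diff_divide_distrib) (simp add: add_divide_distrib distrib_right)
    qed
    ultimately show ?thesis
      by (rule Lim_transform_eventually)
  qed
  hence "(\<lambda>N. ereal (lb (real N))) \<longlonglongrightarrow> ereal (1 - (\<theta> + \<epsilon>) / \<theta> * a powr d)"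
    using filterlim_compose filterlim_real_sequentially by (intro tendsto_intros) blast
  hence "ereal (1 - (\<theta> + \<epsilon>) / \<theta> * a powr d) = limsup (\<lambda>N. ereal (lb (real N)))"
    by (intro lim_imp_Limsup[symmetric]) auto
  also have "\<dots> \<le> limsup (\<lambda>N. ereal (1 / ln (real N) * q N))"
    by (intro Limsup_mono ev)
  finally show ?thesis unfolding q_def .
qed

theorem proposition1p5:
  fixes \<alpha> d \<theta> x x\<^sub>0 :: real
    and V \<phi> g :: "real \<Rightarrow> real"
  assumes "0 < \<alpha>"
    and "admissible_potential d \<theta> \<phi> V"
    and "(g = log_kernel \<and> x\<^sub>0 = 0) \<or>
         (\<exists>s. 0 < s \<and> s < 1 \<and> g = riesz_kernel s \<and> x\<^sub>0 = 2 * s / (1 + s))"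
    and "x\<^sub>0 < x" and "x < 1"
  shows "limsup (\<lambda>N. ereal (1 / ln (real N) *
           ln (ln (inverse (measure (gas_measure \<alpha> g V N)
             {\<omega> \<in> space (gas_measure \<alpha> g V N). scaled_x_max d \<theta> N \<omega> < 1 - x})))))
         \<ge> ereal (1 - (1 - x) powr d)"
proof -
  from assms(2) have d: "1 \<le> d" and \<theta>: "0 < \<theta>" and V: "continuous_on UNIV V"
    by (auto simp: admissible_potential_def)
  have moments: "(\<integral>\<^sup>+u. ennreal ((1 + \<bar>u\<bar>) powr p * exp (- V u)) \<partial>lborel) < \<infinity>" for p
    using \<theta> admissible_potential_growth(2)[OF assms(2), of 1]
    by (intro nn_integral_moment_finite[where c = "\<theta> / 2"] V) auto
  have "\<exists>\<beta> C s. tame_gas \<alpha> \<beta> C s g V"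
    using assms(3)
  proof (elim disjE exE conjE)
    assume g: "g = log_kernel"
    \<comment> \<open>The constants 1, 2 and 1/2 are those of
      \<open>log_kernel_bounds\<close>.\<close>
    have "tame_gas \<alpha> 1 2 (1 / 2) g V"
      unfolding g
      by standard (use \<open>0 < \<alpha>\<close> V moments log_kernel_bounds in
        \<open>auto simp: log_kernel_def[abs_def] algebra_simps\<close>)
    thus ?thesis by blast
  next
    fix s assume s: "0 < s" "s < 1" and g: "g = riesz_kernel s"
    \<comment> \<open>The Riesz kernel is nonnegative, which is the lower bound with \<beta> = 0.
      The upper one is an equality with \<open>C = 1\<close>.\<close>
    have "tame_gas \<alpha> 0 1 s g V"
      unfolding g by standard (use \<open>0 < \<alpha>\<close> V moments s in \<open>auto simp: riesz_kernel_def[abs_def]\<close>)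
    thus ?thesis by blast
  qed
  then obtain \<beta> C s where "tame_gas \<alpha> \<beta> C s g V" by blast
  then interpret tame_gas \<alpha> \<beta> C s g V .
  define l where "l = limsup (\<lambda>N. ereal (1 / ln (real N) *
           ln (ln (inverse (measure (gas_measure \<alpha> g V N)
             {\<omega> \<in> space (gas_measure \<alpha> g V N). scaled_x_max d \<theta> N \<omega> < 1 - x})))))"
  \<comment> \<open>The limsup \<open>l\<close> does not depend on \<epsilon>, so the bounds pass to
    the limit as \<epsilon> decreases to 0.\<close>
  have "\<forall>\<^sub>F \<epsilon> in at_right 0. ereal (1 - (\<theta> + \<epsilon>) / \<theta> * (1 - x) powr d) \<le> l"
    using eventually_at_right_less[of 0]
  proof eventually_elim
    case (elim \<epsilon>)
    show ?case
      unfolding l_def using assms(2,5) d \<theta> elim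
      by (intro limsup_void_probability_ge admissible_potential_growth(1)) auto
  qed
  moreover have "((\<lambda>\<epsilon>. ereal (1 - (\<theta> + \<epsilon>) / \<theta> * (1 - x) powr d)) \<longlongrightarrow> ereal (1 - (\<theta> + 0) / \<theta> * (1 - x) powr d))
      (at_right 0)"
    using \<theta> by (intro tendsto_intros) auto
  ultimately have "ereal (1 - (\<theta> + 0) / \<theta> * (1 - x) powr d) \<le> l"
    by (intro tendsto_upperbound[where F = "at_right 0"]) auto
  thus ?thesis using \<theta> by (simp add: l_def)
qed

end
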